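(* Let $K$ be a field, $n\geq 1$, $S=K[x_1,\ldots,x_n]$, and let $I\subset S$ be a monomial ideal with $I\neq S$. Then $\operatorname{sdepth}(S/I)\geq n-g(I)$.
   Context: For a monomial ideal $I\subset S$, $G(I)$ denotes its set of minimal monomial generators and $g(I)=|G(I)|$. $S$ is given the standard $\mathbb{Z}^n$-grading, with $\deg x_i$ the $i$-th unit vector. Let $M\neq 0$ be a finitely generated $\mathbb{Z}^n$-graded $S$-module. A Stanley decomposition of $M$ is a direct sum decomposition of $K$-vector spaces $\mathcal{D}: M=\bigoplus_{i=1}^r m_iK[Z_i]$ where each $m_i\in M$ is homogeneous, $Z_i\subset\{x_1,\ldots,x_n\}$, and $m_iK[Z_i]$ is a free $K[Z_i]$-module. Put $\operatorname{sdepth}(\mathcal{D})=\min_{1\le i\le r}|Z_i|$. The Stanley depth of $M$ is $\operatorname{sdepth}(M)=\max\{\operatorname{sdepth}(\mathcal{D}) : \mathcal{D}\text{ a Stanley decomposition of }M\}$. *)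

theory Defs
  imports "HOL-Algebra.QuotRing" "HOL-Algebra.Module" "HOL-Library.Poly_Mapping" "HOL-Library.Cardinality"
begin

section \<open>The polynomial ring and monomial ideals\<close>

text \<open>The finite type \<open>'n\<close> indexes the variables, so that the number of variables is
  \<open>CARD('n) \<ge> 1\<close>. A polynomial is a finitely supported map from exponent vectors to
  coefficients; multiplication in \<^theory>\<open>HOL-Library.Poly_Mapping\<close> is convolution.\<close>

type_synonym ('n, 'k) mpoly = "('n \<Rightarrow>\<^sub>0 nat) \<Rightarrow>\<^sub>0 'k"

definition poly_ring :: "('n::finite, 'k::field) mpoly ring" where
  "poly_ring = \<lparr>carrier = UNIV, mult = (*), one = 1, zero = 0, add = (+)\<rparr>"

definition monomials :: "('n::finite, 'k::field) mpoly set" where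
  "monomials = {Poly_Mapping.single t 1 | t. True}"

definition monomial_ideal :: "('n::finite, 'k::field) mpoly set \<Rightarrow> bool" where
  "monomial_ideal I \<longleftrightarrow> (\<exists>G \<subseteq> monomials. I = Idl\<^bsub>poly_ring\<^esub> G)"

definition is_min_monomial_gens ::
    "('n::finite, 'k::field) mpoly set \<Rightarrow> ('n, 'k) mpoly set \<Rightarrow> bool" where
  "is_min_monomial_gens I G \<longleftrightarrow>
     G \<subseteq> monomials \<and> Idl\<^bsub>poly_ring\<^esub> G = I \<and> (\<forall>H. H \<subset> G \<longrightarrow> Idl\<^bsub>poly_ring\<^esub> H \<noteq> I)"

text \<open>Existence and uniqueness for monomial ideals is \<open>ex1_min_monomial_gens\<close> below.\<close>

definition min_monomial_gens ::
    "('n::finite, 'k::field) mpoly set \<Rightarrow> ('n, 'k) mpoly set" where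
  "min_monomial_gens I = (THE G. is_min_monomial_gens I G)"


section \<open>Multigraded modules\<close>

text \<open>Homogeneous polynomials of multidegree \<open>a\<close> (and \<open>0\<close>); this is \<open>{0}\<close> if \<open>a\<close> has a
  negative entry.\<close>

definition poly_component :: "('n::finite \<Rightarrow> int) \<Rightarrow> ('n, 'k::field) mpoly set" where
  "poly_component a = {f. \<forall>t \<in> Poly_Mapping.keys f. \<forall>i. int (Poly_Mapping.lookup t i) = a i}"

text \<open>\<open>M\<close> is the internal direct sum of the subgroups \<open>A j\<close>, \<open>j \<in> J\<close>: every element is a finite
  sum of elements of the \<open>A j\<close> in exactly one way. The families are normalised to vanish
  outside \<open>J\<close>.\<close>

definition is_direct_sum :: "('m, 'b) ring_scheme \<Rightarrow> ('j \<Rightarrow> 'm set) \<Rightarrow> 'j set \<Rightarrow> bool" where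
  "is_direct_sum M A J \<longleftrightarrow>
     (\<forall>j \<in> J. additive_subgroup (A j) M) \<and>
     (\<forall>x \<in> carrier M. \<exists>!h. (\<forall>j \<in> J. h j \<in> A j) \<and> (\<forall>j. j \<notin> J \<longrightarrow> h j = \<zero>\<^bsub>M\<^esub>) \<and>
        finite {j. h j \<noteq> \<zero>\<^bsub>M\<^esub>} \<and> x = finsum M h {j. h j \<noteq> \<zero>\<^bsub>M\<^esub>})"

text \<open>Nonzero finitely generated multigraded modules.\<close>

locale multigraded_module = module "poly_ring :: ('n::finite, 'k::field) mpoly ring" M
  for M :: "(('n::finite, 'k::field) mpoly, 'm) module" (structure) +
  fixes gr :: "('n::finite \<Rightarrow> int) \<Rightarrow> 'm set"
  assumes nonzero: "carrier M \<noteq> {\<zero>}"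
    and finitely_generated: "\<exists>X. finite X \<and> X \<subseteq> carrier M \<and>
          (\<forall>x \<in> carrier M. \<exists>c. x = (\<Oplus>y \<in> X. c y \<odot> y))"
    and grading_direct: "is_direct_sum M gr UNIV"
    and grading_smult: "f \<in> poly_component b \<Longrightarrow> x \<in> gr a \<Longrightarrow> f \<odot> x \<in> gr (\<lambda>i. a i + b i)"

text \<open>The module \<open>S/I\<close> and its induced grading; \<open>multigraded_module_quot\<close> below shows that they
  satisfy the locale.\<close>

definition quot_module ::
    "('n::finite, 'k::field) mpoly set \<Rightarrow> (('n, 'k) mpoly, ('n, 'k) mpoly set) module" where
  "quot_module I =
     (let Q = poly_ring Quot I in
      \<lparr>carrier = carrier Q, mult = mult Q, one = one Q, zero = zero Q, add = add Q,
       smult = (\<lambda>f X. (I +>\<^bsub>poly_ring\<^esub> f) \<otimes>\<^bsub>Q\<^esub> X)\<rparr>)"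

definition quot_grading ::
    "('n::finite, 'k::field) mpoly set \<Rightarrow> ('n \<Rightarrow> int) \<Rightarrow> ('n, 'k) mpoly set set" where
  "quot_grading I a = (\<lambda>f. I +>\<^bsub>poly_ring\<^esub> f) ` poly_component a"


section \<open>Stanley depth\<close>

definition polys_in :: "'n set \<Rightarrow> ('n::finite, 'k::field) mpoly set" where
  "polys_in Z = {f. \<forall>t \<in> Poly_Mapping.keys f. Poly_Mapping.keys t \<subseteq> Z}"

definition stanley_space ::
    "(('n::finite, 'k::field) mpoly, 'm) module \<Rightarrow> 'm \<Rightarrow> 'n set \<Rightarrow> 'm set" where
  "stanley_space M m Z = (\<lambda>f. f \<odot>\<^bsub>M\<^esub> m) ` polys_in Z"

text \<open>A decomposition is the list of the pairs \<open>(m\<^sub>i, Z\<^sub>i)\<close>. The injectivity condition says that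
  \<open>m\<^sub>i\<close> is a basis of the \<open>K[Z\<^sub>i]\<close>-module \<open>m\<^sub>i K[Z\<^sub>i]\<close>; in particular \<open>m\<^sub>i\<close> is nonzero.\<close>

definition stanley_decomposition ::
    "(('n::finite, 'k::field) mpoly, 'm) module \<Rightarrow> (('n \<Rightarrow> int) \<Rightarrow> 'm set) \<Rightarrow>
     ('m \<times> 'n set) list \<Rightarrow> bool" where
  "stanley_decomposition M gr D \<longleftrightarrow>
     (\<forall>(m, Z) \<in> set D. (\<exists>a. m \<in> gr a) \<and> inj_on (\<lambda>f. f \<odot>\<^bsub>M\<^esub> m) (polys_in Z)) \<and>
     is_direct_sum M (\<lambda>i. stanley_space M (fst (D ! i)) (snd (D ! i))) {..<length D}"

definition sdepth_of_decomposition :: "('m \<times> 'n set) list \<Rightarrow> nat" where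
  "sdepth_of_decomposition D = Min ((\<lambda>(m, Z). card Z) ` set D)"

definition sdepth ::
    "(('n::finite, 'k::field) mpoly, 'm) module \<Rightarrow> (('n \<Rightarrow> int) \<Rightarrow> 'm set) \<Rightarrow> nat" where
  "sdepth M gr = Max {sdepth_of_decomposition D | D. stanley_decomposition M gr D}"


section \<open>The definitions apply to quotients by monomial ideals\<close>

lemma poly_ring_simps [simp]:
  "carrier poly_ring = UNIV" "mult poly_ring = (*)" "one poly_ring = 1"
  "zero poly_ring = 0" "add poly_ring = (+)"
  by (simp_all add: poly_ring_def)

lemma cring_poly_ring: "cring (poly_ring :: ('n::finite, 'k::field) mpoly ring)"
proof (rule cringI)
  show "abelian_group (poly_ring :: ('n, 'k) mpoly ring)"
  proof (rule abelian_groupI)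
    show "\<exists>y\<in>carrier poly_ring. y \<oplus>\<^bsub>poly_ring\<^esub> x = \<zero>\<^bsub>poly_ring\<^esub>"
      for x :: "('n, 'k) mpoly"
      by (rule bexI[of _ "- x"]) simp_all
  qed (simp_all add: add_ac)
  show "comm_monoid (poly_ring :: ('n, 'k) mpoly ring)"
    by (rule comm_monoidI) (simp_all add: mult_ac)
qed (simp add: distrib_right)

lemma ideal_poly_ringI:
  fixes I :: "('n::finite, 'k::field) mpoly set"
  assumes "0 \<in> I" "\<And>f g. f \<in> I \<Longrightarrow> g \<in> I \<Longrightarrow> f + g \<in> I" "\<And>f g. f \<in> I \<Longrightarrow> g * f \<in> I"
  shows "ideal I poly_ring"
proof -
  interpret R: cring "poly_ring :: ('n, 'k) mpoly ring" by (rule cring_poly_ring)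
  have sg: "subgroup I (add_monoid (poly_ring :: ('n, 'k) mpoly ring))"
  proof (rule R.add.subgroupI)
    fix a assume "a \<in> I"
    have "\<ominus>\<^bsub>poly_ring\<^esub> a = - a"
      by (rule R.add.inv_equality) auto
    then show "\<ominus>\<^bsub>poly_ring\<^esub> a \<in> I" using assms(3)[OF \<open>a \<in> I\<close>, of "-1"] by simp
  qed (use assms in auto)
  show ?thesis
    by (rule idealI[OF R.ring_axioms sg]) (use assms(3) in \<open>auto simp: mult.commute\<close>)
qed

lemma ideal_poly_ringD:
  fixes I :: "('n::finite, 'k::field) mpoly set"
  assumes "ideal I poly_ring"
  shows "0 \<in> I" "\<And>f g. f \<in> I \<Longrightarrow> g \<in> I \<Longrightarrow> f + g \<in> I" "\<And>f g. f \<in> I \<Longrightarrow> g * f \<in> I"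
    and "\<And>f g. f \<in> I \<Longrightarrow> g \<in> I \<Longrightarrow> f - g \<in> I"
    and "\<And>h A. finite A \<Longrightarrow> (\<And>a. a \<in> A \<Longrightarrow> h a \<in> I) \<Longrightarrow> sum h A \<in> I"
proof -
  interpret ideal I poly_ring by fact
  show 0: "0 \<in> I" using additive_subgroup.zero_closed[OF is_additive_subgroup] by simp
  show add: "f + g \<in> I" if "f \<in> I" "g \<in> I" for f g 
    using additive_subgroup.a_closed[OF is_additive_subgroup that] by simp
  show mult: "g * f \<in> I" if "f \<in> I" for f g using I_l_closed[OF that, of g] by simp
  show "f - g \<in> I" if "f \<in> I" "g \<in> I" for f g
    using add[OF that(1) mult[OF that(2), of "-1"]] by simp
  show "sum h A \<in> I" if "finite A" "\<And>a. a \<in> A \<Longrightarrow> h a \<in> I" for h :: "'b \<Rightarrow> _" and A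
    using that by (induction A rule: finite_induct) (auto intro: 0 add)
qed

lemma poly_eq_sum_terms:
  fixes f :: "('n::finite, 'k::field) mpoly"
  assumes "finite A" "Poly_Mapping.keys f \<subseteq> A"
  shows "f = (\<Sum>t\<in>A. Poly_Mapping.single t (Poly_Mapping.lookup f t))"
proof (rule poly_mapping_eqI)
  fix s
  have "Poly_Mapping.lookup (\<Sum>t\<in>A. Poly_Mapping.single t (Poly_Mapping.lookup f t)) s
      = (\<Sum>t\<in>A. if t = s then Poly_Mapping.lookup f s else 0)"
    by (auto simp: lookup_sum lookup_single when_def intro!: sum.cong)
  also have "\<dots> = Poly_Mapping.lookup f s"
    using assms by (auto simp: in_keys_iff)
  finally show "Poly_Mapping.lookup f s
      = Poly_Mapping.lookup (\<Sum>t\<in>A. Poly_Mapping.single t (Poly_Mapping.lookup f t)) s" ..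
qed

text \<open>A monomial ideal is spanned by the multiples of its generators.\<close>

lemma Idl_monomials:
  fixes G :: "('n::finite, 'k::field) mpoly set"
  assumes G: "G \<subseteq> monomials"
  shows "Idl\<^bsub>poly_ring\<^esub> G =
    {f. \<forall>t \<in> Poly_Mapping.keys f. \<exists>s u. Poly_Mapping.single s 1 \<in> G \<and> t = u + s}"
    (is "_ = ?J")
proof
  interpret R: cring "poly_ring :: ('n, 'k) mpoly ring" by (rule cring_poly_ring)
  have J: "ideal ?J poly_ring"
  proof (rule ideal_poly_ringI)
    show "f + g \<in> ?J" if "f \<in> ?J" "g \<in> ?J" for f g
      using that Poly_Mapping.keys_add[of f g] by blast
    show "g * f \<in> ?J" if "f \<in> ?J" for f g
    proof (clarify)
      fix t assume "t \<in> Poly_Mapping.keys (g * f)"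
      then obtain a b where ab: "t = a + b" "b \<in> Poly_Mapping.keys f"
        using keys_mult[of g f] by blast
      with that obtain s u where "Poly_Mapping.single s 1 \<in> G" "b = u + s"
        by blast
      then show "\<exists>s u. Poly_Mapping.single s 1 \<in> G \<and> t = u + s"
        by (intro exI[of _ s] exI[of _ "a + u"]) (simp add: ab(1) add.assoc)
    qed
  qed auto
  have "G \<subseteq> ?J"
  proof
    fix f assume "f \<in> G"
    with G obtain s where s: "f = Poly_Mapping.single s 1" by (auto simp: monomials_def)
    then have "t = 0 + s" if "t \<in> Poly_Mapping.keys f" for t using that by simp
    with \<open>f \<in> G\<close> s show "f \<in> ?J" by blast
  qed
  with J show "Idl\<^bsub>poly_ring\<^esub> G \<subseteq> ?J" by (rule R.genideal_minimal)
  have I: "ideal (Idl\<^bsub>poly_ring\<^esub> G) poly_ring" "G \<subseteq> Idl\<^bsub>poly_ring\<^esub> G"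
    by (simp_all add: R.genideal_ideal R.genideal_self)
  show "?J \<subseteq> Idl\<^bsub>poly_ring\<^esub> G"
  proof
    fix f assume f: "f \<in> ?J"
    have "Poly_Mapping.single t (Poly_Mapping.lookup f t) \<in> Idl\<^bsub>poly_ring\<^esub> G"
      if t: "t \<in> Poly_Mapping.keys f" for t
    proof -
      from f t obtain s u where su: "Poly_Mapping.single s 1 \<in> G" "t = u + s" by blast
      have "Poly_Mapping.single u (Poly_Mapping.lookup f t) * Poly_Mapping.single s 1
          \<in> Idl\<^bsub>poly_ring\<^esub> G"
        by (rule ideal_poly_ringD(3)[OF I(1)]) (use su I in auto)
      then show ?thesis by (simp add: mult_single su)
    qed
    then have "(\<Sum>t\<in>Poly_Mapping.keys f. Poly_Mapping.single t (Poly_Mapping.lookup f t))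
        \<in> Idl\<^bsub>poly_ring\<^esub> G"
      by (intro ideal_poly_ringD(5)[OF I(1)]) auto
    then show "f \<in> Idl\<^bsub>poly_ring\<^esub> G"
      using poly_eq_sum_terms[of "Poly_Mapping.keys f" f] by simp
  qed
qed

lemma ex1_min_monomial_gens:
  fixes I :: "('n::finite, 'k::field) mpoly set"
  assumes "monomial_ideal I"
  shows "\<exists>!G. is_min_monomial_gens I G"
proof -
  let ?x = "\<lambda>t. Poly_Mapping.single t 1 :: ('n, 'k) mpoly"
  define E where "E = {t. ?x t \<in> I}"
  define N where "N = {t \<in> E. \<forall>s u. s \<in> E \<longrightarrow> t = u + s \<longrightarrow> s = t}"
  have inj: "?x s = ?x t \<longleftrightarrow> s = t" for s t
    by (metis keys_single one_neq_zero singleton_inject)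
  have anti: "s = t" if "t = u + s" "s = v + t" for s t u v :: "'n \<Rightarrow>\<^sub>0 nat"
  proof -
    have "Poly_Mapping.lookup t i = Poly_Mapping.lookup u i + Poly_Mapping.lookup s i" for i
      by (subst that(1)) (simp add: lookup_add)
    moreover have "Poly_Mapping.lookup s i = Poly_Mapping.lookup v i + Poly_Mapping.lookup t i" for i
      by (subst that(2)) (simp add: lookup_add)
    ultimately show ?thesis
      by (intro poly_mapping_eqI) (metis add_leD2 le_antisym order_refl)
  qed
  have NI: "\<exists>s u. s \<in> N \<and> t = u + s" if "t \<in> E" for t
    using that
  proof (induction "\<Sum>i\<in>UNIV. Poly_Mapping.lookup t i" arbitrary: t rule: less_induct)
    case less
    show ?case
    proof (cases "t \<in> N")
      case True
      then show ?thesis by (intro exI[of _ t] exI[of _ 0]) simp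
    next
      case False
      with less.prems obtain s u where s: "s \<in> E" "t = u + s" "s \<noteq> t" by (auto simp: N_def)
      then obtain i where i: "Poly_Mapping.lookup s i \<noteq> Poly_Mapping.lookup t i"
        by (metis poly_mapping_eqI)
      have "(\<Sum>i\<in>UNIV. Poly_Mapping.lookup s i) < (\<Sum>i\<in>UNIV. Poly_Mapping.lookup t i)"
        by (rule sum_strict_mono_ex1)
          (use i s(2) in \<open>auto simp: lookup_add intro!: exI[of _ i]\<close>)
      from less.hyps[OF this s(1)] obtain r v where "r \<in> N" "s = v + r" by blast
      then show ?thesis using s(2) by (intro exI[of _ r] exI[of _ "u + v"]) (simp add: add.assoc)
    qed
  qed
  from assms obtain G0 where G0: "G0 \<subseteq> monomials" "I = Idl\<^bsub>poly_ring\<^esub> G0"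
    by (auto simp: monomial_ideal_def)
  have gen: "t \<in> E \<longleftrightarrow> (\<exists>s u. ?x s \<in> G \<and> t = u + s)"
    if "G \<subseteq> monomials" "Idl\<^bsub>poly_ring\<^esub> G = I" for G t
    unfolding E_def that(2)[symmetric] Idl_monomials[OF that(1)] by simp
  have IE: "f \<in> I \<longleftrightarrow> Poly_Mapping.keys f \<subseteq> E" for f
    using gen[OF G0(1) G0(2)[symmetric]] unfolding G0(2) Idl_monomials[OF G0(1)] by auto
  have Nsub: "?x ` N \<subseteq> G" if GI: "G \<subseteq> monomials" "Idl\<^bsub>poly_ring\<^esub> G = I" for G
  proof
    fix f assume "f \<in> ?x ` N"
    then obtain t where t: "t \<in> N" "f = ?x t" by blast
    then obtain s u where su: "?x s \<in> G" "t = u + s"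
      using gen[OF GI] by (auto simp: N_def)
    moreover have "s \<in> E"
      unfolding gen[OF GI] using su(1) by (intro exI[of _ s] exI[of _ 0]) simp
    ultimately have "s = t" using t by (auto simp: N_def)
    then show "f \<in> G" using su(1) t(2) by blast
  qed
  have xN: "?x ` N \<subseteq> monomials" by (auto simp: monomials_def)
  have Nu: "u + s \<in> E" if "s \<in> N" for u s
  proof -
    have "s \<in> E" using that by (simp add: N_def)
    then obtain r v where "?x r \<in> G0" "s = v + r"
      using gen[OF G0(1) G0(2)[symmetric]] by blast
    then show ?thesis
      unfolding gen[OF G0(1) G0(2)[symmetric]]
      by (intro exI[of _ r] exI[of _ "u + v"]) (simp add: add.assoc)
  qed
  have NIdl: "Idl\<^bsub>poly_ring\<^esub> (?x ` N) = I"
  proof -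
    have "(\<exists>s u. ?x s \<in> ?x ` N \<and> t = u + s) \<longleftrightarrow> t \<in> E" for t
      using NI[of t] Nu by (auto simp: image_iff inj)
    then show ?thesis unfolding Idl_monomials[OF xN] by (auto simp: IE)
  qed
  show ?thesis
  proof (rule ex1I[of _ "?x ` N"])
    show "is_min_monomial_gens I (?x ` N)"
      unfolding is_min_monomial_gens_def
    proof (intro conjI allI impI)
      fix H assume H: "H \<subset> ?x ` N"
      then show "Idl\<^bsub>poly_ring\<^esub> H \<noteq> I" using Nsub[of H] xN by blast
    qed (fact xN NIdl)+
    show "G = ?x ` N" if "is_min_monomial_gens I G" for G
      using that Nsub[of G] NIdl unfolding is_min_monomial_gens_def by blast
  qed
qed

lemma quot_module_simps:
  "carrier (quot_module I) = (\<lambda>f. I +>\<^bsub>poly_ring\<^esub> f) ` UNIV"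
  "zero (quot_module I) = I"
  by (auto simp: quot_module_def Let_def FactRing_def A_RCOSETS_def')

lemma multigraded_module_quot:
  fixes I :: "('n::finite, 'k::field) mpoly set"
  assumes mono: "monomial_ideal I" and proper: "I \<noteq> carrier poly_ring"
  shows "multigraded_module (quot_module I) (quot_grading I)"
proof -
  interpret R: cring "poly_ring :: ('n, 'k) mpoly ring" by (rule cring_poly_ring)
  from mono obtain G where G: "G \<subseteq> monomials" "I = Idl\<^bsub>poly_ring\<^esub> G"
    by (auto simp: monomial_ideal_def)
  have idI: "ideal I poly_ring" unfolding G(2) by (rule R.genideal_ideal) simp
  interpret ideal I poly_ring by (fact idI)
  note I = ideal_poly_ringD[OF idI]
  define p where "p = (\<lambda>f. I +>\<^bsub>poly_ring\<^esub> f)"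
  let ?M = "quot_module I"
  have carr: "carrier ?M = p ` UNIV" by (simp add: quot_module_simps p_def)
  have p0: "p 0 = I" by (simp add: p_def a_r_coset_def')
  have zero: "zero ?M = p 0" by (simp add: quot_module_simps p0)
  have add: "p f \<oplus>\<^bsub>?M\<^esub> p g = p (f + g)" for f g
    using a_rcos_sum[of f g] by (simp add: quot_module_def Let_def FactRing_def p_def)
  have smult: "f \<odot>\<^bsub>?M\<^esub> p g = p (f * g)" for f g
    using rcoset_mult_add[of f g] by (simp add: quot_module_def Let_def FactRing_def p_def)
  have peq: "p f = p g \<longleftrightarrow> f - g \<in> I" for f g
  proof
    assume "p f = p g"
    moreover have "f \<in> p f" using I(1) by (auto simp: p_def a_r_coset_def')
    ultimately show "f - g \<in> I" by (auto simp: p_def a_r_coset_def')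
  next
    have sub: "p f \<subseteq> p g" if "f - g \<in> I" for f g
    proof
      fix x assume "x \<in> p f"
      then have "x - f \<in> I" by (auto simp: p_def a_r_coset_def')
      then have "x - g \<in> I" using I(2)[OF _ that] by fastforce
      then show "x \<in> p g" by (auto simp: p_def a_r_coset_def' intro!: bexI[of _ "x - g"])
    qed
    assume "f - g \<in> I"
    moreover from I(4)[OF I(1) this] have "g - f \<in> I" by simp
    ultimately show "p f = p g" using sub by blast
  qed
  have ag: "abelian_group ?M"
  proof (rule abelian_groupI)
    fix x assume "x \<in> carrier ?M"
    then obtain f where "x = p f" by (auto simp: carr)
    then show "\<exists>y\<in>carrier ?M. y \<oplus>\<^bsub>?M\<^esub> x = \<zero>\<^bsub>?M\<^esub>"
      by (intro bexI[of _ "p (- f)"]) (simp_all add: carr add zero)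
  qed (auto simp: carr zero add add_ac)
  have md: "module poly_ring ?M"
    by (rule moduleI[OF cring_poly_ring ag]) (auto simp: carr smult add algebra_simps)
  interpret M: module poly_ring ?M by (rule md)
  have fsum: "finsum ?M (\<lambda>j. p (g j)) A = p (sum g A)" if "finite A" for g and A :: "'j set"
    using that
  proof (induction A rule: finite_induct)
    case empty
    then show ?case by (simp add: zero)
  next
    case (insert a A)
    then show ?case by (subst M.finsum_insert) (auto simp: carr add)
  qed
  define deg :: "('n \<Rightarrow>\<^sub>0 nat) \<Rightarrow> 'n \<Rightarrow> int" where
    "deg t = (\<lambda>i. int (Poly_Mapping.lookup t i))" for t
  define c where "c f a = (\<Sum>t | t \<in> Poly_Mapping.keys f \<and> deg t = a.
      Poly_Mapping.single t (Poly_Mapping.lookup f t))"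
    for f :: "('n, 'k) mpoly" and a :: "'n \<Rightarrow> int"
  have pc: "f \<in> poly_component a \<longleftrightarrow> (\<forall>t\<in>Poly_Mapping.keys f. deg t = a)"
    for f :: "('n, 'k) mpoly" and a
    by (auto simp: poly_component_def deg_def fun_eq_iff)
  have lc: "Poly_Mapping.lookup (c f a) t = (if deg t = a then Poly_Mapping.lookup f t else 0)"
    for f a t
  proof -
    have "Poly_Mapping.lookup (c f a) t
        = (\<Sum>s | s \<in> Poly_Mapping.keys f \<and> deg s = a. if s = t then Poly_Mapping.lookup f t else 0)"
      unfolding c_def by (auto simp: lookup_sum lookup_single when_def intro!: sum.cong)
    also have "\<dots> = (if deg t = a then Poly_Mapping.lookup f t else 0)"
      by (auto simp: in_keys_iff)
    finally show ?thesis .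
  qed
  have cpc: "c f a \<in> poly_component a" for f a
    by (auto simp: pc in_keys_iff lc split: if_splits)
  have cI: "c f a \<in> I" if "f \<in> I" for f a
  proof -
    have "Poly_Mapping.keys (c f a) \<subseteq> Poly_Mapping.keys f"
      by (auto simp: in_keys_iff lc split: if_splits)
    then show ?thesis using that unfolding G(2) Idl_monomials[OF G(1)] by blast
  qed
  have csum: "sum (c f) A = f" if "finite A" "deg ` Poly_Mapping.keys f \<subseteq> A" for f A
  proof (rule poly_mapping_eqI)
    fix t
    have "Poly_Mapping.lookup f t = 0" if "deg t \<notin> A"
      using that \<open>deg ` Poly_Mapping.keys f \<subseteq> A\<close> by (metis image_subset_iff in_keys_iff)
    then show "Poly_Mapping.lookup (sum (c f) A) t = Poly_Mapping.lookup f t"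
      using \<open>finite A\<close> by (auto simp: lookup_sum lc)
  qed
  have csumh: "c (sum g A) b = (if b \<in> A then g b else 0)"
    if "finite A" "\<And>a. a \<in> A \<Longrightarrow> g a \<in> poly_component a" for g A b
  proof (rule poly_mapping_eqI)
    fix t
    have z: "Poly_Mapping.lookup (g a) t = 0" if "a \<in> A" "deg t \<noteq> a" for a
      using that \<open>\<And>a. a \<in> A \<Longrightarrow> g a \<in> poly_component a\<close>[of a] by (auto simp: pc in_keys_iff)
    have "(\<Sum>a\<in>A. Poly_Mapping.lookup (g a) t)
        = (\<Sum>a\<in>A. if a = deg t then Poly_Mapping.lookup (g a) t else 0)"
      by (rule sum.cong) (auto simp: z)
    then show "Poly_Mapping.lookup (c (sum g A) b) t
        = Poly_Mapping.lookup (if b \<in> A then g b else 0) t"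
      using \<open>finite A\<close> z by (auto simp: lc lookup_sum)
  qed
  have cdiff: "c (f - g) a = c f a - c g a" for f g a
    by (rule poly_mapping_eqI) (simp add: lc lookup_minus)
  have gr: "quot_grading I a = p ` poly_component a" for a
    by (simp add: quot_grading_def p_def)
  have "is_direct_sum ?M (quot_grading I) UNIV"
    unfolding is_direct_sum_def
  proof (intro conjI ballI)
    fix a
    have "subgroup (quot_grading I a) (add_monoid ?M)"
    proof (rule M.M.add.subgroupI)
      show "quot_grading I a \<subseteq> carrier ?M" by (auto simp: gr carr)
      have "(0 :: ('n, 'k) mpoly) \<in> poly_component a" by (simp add: pc)
      then show "quot_grading I a \<noteq> {}" by (auto simp: gr)
    next
      fix x assume "x \<in> quot_grading I a"
      then obtain f where f: "x = p f" "f \<in> poly_component a" by (auto simp: gr)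
      have "\<ominus>\<^bsub>?M\<^esub> x = p (- f)"
        by (rule M.M.add.inv_equality) (auto simp: f add zero carr)
      moreover have "- f \<in> poly_component a" using f(2) by (simp add: pc in_keys_iff)
      ultimately show "\<ominus>\<^bsub>?M\<^esub> x \<in> quot_grading I a" by (auto simp: gr)
    next
      fix x y assume "x \<in> quot_grading I a" "y \<in> quot_grading I a"
      then obtain f g where fg: "x = p f" "f \<in> poly_component a" "y = p g" "g \<in> poly_component a"
        by (auto simp: gr)
      moreover have "f + g \<in> poly_component a"
        using fg Poly_Mapping.keys_add[of f g] unfolding pc by blast
      ultimately show "x \<oplus>\<^bsub>?M\<^esub> y \<in> quot_grading I a" by (auto simp: gr add)
    qed
    then show "additive_subgroup (quot_grading I a) ?M" by (rule additive_subgroup.intro)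
  next
    fix x assume "x \<in> carrier ?M"
    then obtain f where x: "x = p f" by (auto simp: carr)
    define h where "h a = p (c f a)" for a
    have supp: "{a. h a \<noteq> \<zero>\<^bsub>?M\<^esub>} \<subseteq> deg ` Poly_Mapping.keys f"
    proof
      fix a assume "a \<in> {a. h a \<noteq> \<zero>\<^bsub>?M\<^esub>}"
      then have "c f a \<noteq> 0" by (auto simp: h_def zero)
      then obtain t where "Poly_Mapping.lookup (c f a) t \<noteq> 0"
        by (metis lookup_zero poly_mapping_eqI)
      then show "a \<in> deg ` Poly_Mapping.keys f" by (auto simp: lc in_keys_iff split: if_splits)
    qed
    show "\<exists>!h. (\<forall>j\<in>UNIV. h j \<in> quot_grading I j) \<and> (\<forall>j. j \<notin> UNIV \<longrightarrow> h j = \<zero>\<^bsub>?M\<^esub>) \<and>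
        finite {j. h j \<noteq> \<zero>\<^bsub>?M\<^esub>} \<and> x = finsum ?M h {j. h j \<noteq> \<zero>\<^bsub>?M\<^esub>}"
    proof (rule ex1I[of _ h], intro conjI)
      show fin: "finite {j. h j \<noteq> \<zero>\<^bsub>?M\<^esub>}" by (rule finite_subset[OF supp]) simp
      have "finsum ?M h {j. h j \<noteq> \<zero>\<^bsub>?M\<^esub>} = finsum ?M h (deg ` Poly_Mapping.keys f)"
        by (rule M.add.finprod_mono_neutral_cong_left) (use supp in \<open>auto simp: h_def carr\<close>)
      also have "\<dots> = p f" using csum[of "deg ` Poly_Mapping.keys f" f] by (simp add: h_def[abs_def] fsum)
      finally show "x = finsum ?M h {j. h j \<noteq> \<zero>\<^bsub>?M\<^esub>}" by (simp add: x)
      show "\<forall>j\<in>UNIV. h j \<in> quot_grading I j" by (auto simp: h_def gr cpc)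
    next
      fix k assume k: "(\<forall>j\<in>UNIV. k j \<in> quot_grading I j) \<and> (\<forall>j. j \<notin> UNIV \<longrightarrow> k j = \<zero>\<^bsub>?M\<^esub>) \<and>
        finite {j. k j \<noteq> \<zero>\<^bsub>?M\<^esub>} \<and> x = finsum ?M k {j. k j \<noteq> \<zero>\<^bsub>?M\<^esub>}"
      then have "\<forall>j. \<exists>g. k j = p g \<and> g \<in> poly_component j" by (auto simp: gr)
      then obtain g where g: "\<And>j. k j = p (g j)" "\<And>j. g j \<in> poly_component j" by metis
      define A where "A = {j. k j \<noteq> \<zero>\<^bsub>?M\<^esub>}"
      have A: "finite A" "x = finsum ?M k A" using k by (auto simp: A_def)
      have "k = (\<lambda>j. p (g j))" using g(1) by blast
      with A(2) fsum[OF A(1), of g] x have "p f = p (sum g A)" by metis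
      then have "c (f - sum g A) j \<in> I" for j using peq cI by blast
      then have *: "p (c f j) = p (if j \<in> A then g j else 0)" for j
        using csumh[OF A(1) g(2)] by (simp add: cdiff peq)
      show "k = h"
      proof
        fix j show "k j = h j"
          using *[of j] g(1)[of j] by (auto simp: h_def A_def zero split: if_splits)
      qed
    qed simp
  qed
  moreover have "f \<odot>\<^bsub>?M\<^esub> x \<in> quot_grading I (\<lambda>i. a i + b i)"
    if f: "f \<in> poly_component b" and x: "x \<in> quot_grading I a" for f x a b
  proof -
    from x obtain g where g: "x = p g" "g \<in> poly_component a" by (auto simp: gr)
    have "f * g \<in> poly_component (\<lambda>i. a i + b i)"
      unfolding pc
    proof
      fix t assume "t \<in> Poly_Mapping.keys (f * g)"
      then obtain r s where rs: "t = r + s" "r \<in> Poly_Mapping.keys f" "s \<in> Poly_Mapping.keys g"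
        using keys_mult[of f g] by blast
      with f g(2) have "deg r = b" "deg s = a" by (auto simp: pc)
      then show "deg t = (\<lambda>i. a i + b i)"
        by (auto simp: rs(1) deg_def lookup_add)
    qed
    then show ?thesis by (auto simp: g smult gr)
  qed
  moreover have "\<exists>X. finite X \<and> X \<subseteq> carrier ?M \<and>
      (\<forall>x \<in> carrier ?M. \<exists>d. x = finsum ?M (\<lambda>y. d y \<odot>\<^bsub>?M\<^esub> y) X)"
  proof (intro exI[of _ "{p 1}"] conjI ballI)
    fix x assume "x \<in> carrier ?M"
    then obtain f where "x = p f" by (auto simp: carr)
    then show "\<exists>d. x = finsum ?M (\<lambda>y. d y \<odot>\<^bsub>?M\<^esub> y) {p 1}"
      by (intro exI[of _ "\<lambda>_. f"], subst M.finsum_insert) (auto simp: smult carr)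
  qed (auto simp: carr)
  moreover have "carrier ?M \<noteq> {\<zero>\<^bsub>?M\<^esub>}"
  proof
    assume "carrier ?M = {\<zero>\<^bsub>?M\<^esub>}"
    then have "p f = p 0" for f by (auto simp: carr zero)
    then have "f \<in> I" for f using peq[of f 0] by simp
    with proper show False by auto
  qed
  ultimately show ?thesis
    by (intro multigraded_module.intro md multigraded_module_axioms.intro)
qed

end

theory Submission
  imports Defs "HOL-Library.Disjoint_Sets" "HOL.Topological_Spaces"
begin

text \<open>The exponent vectors of the monomials outside \<open>I\<close> are partitioned into boxes, the exponent sets
  of the spaces \<open>x\<^sup>v K[Z]\<close>. Starting from the single box with \<open>Z\<close> the set of all variables, the
  generators are removed one after the other. Removing the multiples of \<open>x\<^sup>u\<close> from a box with
  \<open>v\<^sub>i < u\<^sub>i\<close> and \<open>i \<in> Z\<close> splits off the slice with \<open>t\<^sub>i = v\<^sub>i\<close>, which has no such multiples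
  and one free variable less, and leaves a box in which \<open>v\<^sub>i\<close> has grown. Hence each generator costs at
  most one free variable. By Dickson's lemma there are finitely many generators.\<close>

section \<open>Boxes of exponent vectors\<close>

definition multiples :: "('n \<Rightarrow>\<^sub>0 nat) \<Rightarrow> ('n \<Rightarrow>\<^sub>0 nat) set" where
  "multiples u = {t. \<forall>i. Poly_Mapping.lookup u i \<le> Poly_Mapping.lookup t i}"

definition box :: "('n \<Rightarrow>\<^sub>0 nat) \<Rightarrow> 'n set \<Rightarrow> ('n \<Rightarrow>\<^sub>0 nat) set" where
  "box v Z = {t. \<forall>i. Poly_Mapping.lookup v i \<le> Poly_Mapping.lookup t i \<and>
     (i \<notin> Z \<longrightarrow> Poly_Mapping.lookup t i = Poly_Mapping.lookup v i)}"

text \<open>The family is indexed by the pairs themselves. Every box contains its corner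
  \<open>v\<close>, so disjointness forces distinct pairs to have distinct boxes. Finiteness allows
  the pairs to be listed later.\<close>

definition box_partition ::
    "(('n \<Rightarrow>\<^sub>0 nat) \<times> 'n set) set \<Rightarrow> ('n \<Rightarrow>\<^sub>0 nat) set \<Rightarrow> bool" where
  "box_partition P X \<longleftrightarrow> finite P \<and> disjoint_family_on (\<lambda>(v, Z). box v Z) P \<and>
     (\<Union>(v, Z)\<in>P. box v Z) = X"

lemma multiples_iff: "t \<in> multiples s \<longleftrightarrow> (\<exists>u. t = u + s)"
proof
  assume "t \<in> multiples s"
  \<comment> \<open>The cofactor is \<open>t - s\<close>. Subtraction is truncated in each
    coordinate, hence exact here because \<open>s\<close> lies below \<open>t\<close>.\<close>
  then have "t = (t - s) + s"
    by (intro poly_mapping_eqI) (simp add: multiples_def lookup_add lookup_minus)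
  then show "\<exists>u. t = u + s" ..
qed (auto simp: multiples_def lookup_add)

lemma box_UNIV: "box 0 UNIV = UNIV"
  by (simp add: box_def)

lemma box_iff: "t \<in> box v Z \<longleftrightarrow> (\<exists>w. t = w + v \<and> Poly_Mapping.keys w \<subseteq> Z)"
proof
  assume t: "t \<in> box v Z"
  then have "t = (t - v) + v"
    by (intro poly_mapping_eqI) (simp add: box_def lookup_add lookup_minus)
  moreover have "Poly_Mapping.keys (t - v) \<subseteq> Z"
    using t by (auto simp: box_def in_keys_iff lookup_minus)
  ultimately show "\<exists>w. t = w + v \<and> Poly_Mapping.keys w \<subseteq> Z" by blast
next
  assume "\<exists>w. t = w + v \<and> Poly_Mapping.keys w \<subseteq> Z"
  then show "t \<in> box v Z" by (auto simp: box_def lookup_add in_keys_iff)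
qed

lemma box_partition_empty: "box_partition {} {}"
  by (simp add: box_partition_def disjoint_family_on_def)

lemma box_partition_single: "box_partition {(v, Z)} (box v Z)"
  by (simp add: box_partition_def disjoint_family_on_def)

text \<open>Gluing: two boxes are disjoint either because they belong to the same partition or
  because the sets they partition are disjoint.\<close>

lemma box_partition_UN:
  assumes "finite A" "disjoint_family_on X A" "\<And>a. a \<in> A \<Longrightarrow> box_partition (P a) (X a)"
  shows "box_partition (\<Union>a\<in>A. P a) (\<Union>a\<in>A. X a)"
  unfolding box_partition_def
proof (intro conjI)
  show "finite (\<Union>a\<in>A. P a)" using assms by (auto simp: box_partition_def)
  show "(\<Union>(v, Z)\<in>(\<Union>a\<in>A. P a). box v Z) = (\<Union>a\<in>A. X a)"
    using assms(3) unfolding box_partition_def by blast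
  show "disjoint_family_on (\<lambda>(v, Z). box v Z) (\<Union>a\<in>A. P a)"
    unfolding disjoint_family_on_def
  proof (intro ballI impI)
    fix p q assume pq: "p \<in> (\<Union>a\<in>A. P a)" "q \<in> (\<Union>a\<in>A. P a)" "p \<noteq> q"
    then obtain a b where ab: "a \<in> A" "p \<in> P a" "b \<in> A" "q \<in> P b" by blast
    show "(case p of (v, Z) \<Rightarrow> box v Z) \<inter> (case q of (v, Z) \<Rightarrow> box v Z) = {}"
    proof (cases "a = b")
      case True
      with ab pq(3) assms(3)[of a] show ?thesis
        unfolding box_partition_def disjoint_family_on_def by blast
    next
      case False
      then have "X a \<inter> X b = {}" using assms(2) ab by (auto simp: disjoint_family_on_def)
      moreover have "(case p of (v, Z) \<Rightarrow> box v Z) \<subseteq> X a" "(case q of (v, Z) \<Rightarrow> box v Z) \<subseteq> X b"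
        using ab assms(3)[of a] assms(3)[of b] unfolding box_partition_def by blast+
      ultimately show ?thesis by blast
    qed
  qed
qed

text \<open>The coordinate \<open>i\<close> of a point either equals that of the corner, which
  freezes it, or exceeds it, which raises the corner by one. Since \<open>i\<close> is free in
  \<open>Z\<close>, the raised box stays inside the original one.\<close>

lemma box_split:
  assumes "i \<in> Z"
  shows "box v Z = box v (Z - {i}) \<union> box (v + Poly_Mapping.single i 1) Z"
    and "box v (Z - {i}) \<inter> box (v + Poly_Mapping.single i 1) Z = {}"
proof -
  let ?v = "v + Poly_Mapping.single i 1"
  have v: "Poly_Mapping.lookup ?v j = Poly_Mapping.lookup v j + (if j = i then 1 else 0)" for j
    by (simp add: lookup_add lookup_single when_def)
  have slice: "t \<in> box v (Z - {i}) \<longleftrightarrow>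
      t \<in> box v Z \<and> Poly_Mapping.lookup t i = Poly_Mapping.lookup v i" for t
    unfolding box_def by blast
  have rest: "t \<in> box ?v Z \<longleftrightarrow>
      t \<in> box v Z \<and> Poly_Mapping.lookup v i < Poly_Mapping.lookup t i" for t
  proof -
    have "Poly_Mapping.lookup ?v j \<le> Poly_Mapping.lookup t j \<and>
          (j \<notin> Z \<longrightarrow> Poly_Mapping.lookup t j = Poly_Mapping.lookup ?v j) \<longleftrightarrow>
        (Poly_Mapping.lookup v j \<le> Poly_Mapping.lookup t j \<and>
          (j \<notin> Z \<longrightarrow> Poly_Mapping.lookup t j = Poly_Mapping.lookup v j)) \<and>
        (j = i \<longrightarrow> Poly_Mapping.lookup v i < Poly_Mapping.lookup t i)" for j
      using assms unfolding v by auto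
    then show ?thesis unfolding box_def by blast
  qed
  have "t \<in> box v Z \<Longrightarrow> Poly_Mapping.lookup v i \<le> Poly_Mapping.lookup t i" for t
    unfolding box_def by blast
  then have "t \<in> box v Z \<longleftrightarrow> t \<in> box v (Z - {i}) \<or> t \<in> box ?v Z" for t
    unfolding slice rest by (metis le_neq_implies_less)
  then show "box v Z = box v (Z - {i}) \<union> box ?v Z" by blast
  show "box v (Z - {i}) \<inter> box ?v Z = {}"
    using slice rest by auto
qed

section \<open>Removing the multiples of one monomial, then of finitely many\<close>

lemma box_Int_multiples:
  assumes "i \<notin> Z" "Poly_Mapping.lookup v i < Poly_Mapping.lookup u i"
  shows "box v Z \<inter> multiples u = {}"
proof (rule equals0I)
  fix t assume "t \<in> box v Z \<inter> multiples u"
  then have "Poly_Mapping.lookup t i = Poly_Mapping.lookup v i"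
    "Poly_Mapping.lookup u i \<le> Poly_Mapping.lookup t i"
    using assms(1) unfolding box_def multiples_def by blast+
  with assms(2) show False by simp
qed

text \<open>Induction on the total deficit of \<open>v\<close> below \<open>u\<close>, with
  truncated differences. The recursion moves the corner and keeps \<open>Z\<close>; a slice that has
  been split off is never cut again, so no box loses more than one free variable.\<close>

lemma box_diff_multiples:
  fixes v u :: "'n::finite \<Rightarrow>\<^sub>0 nat"
  shows "\<exists>P. box_partition P (box v Z - multiples u) \<and> (\<forall>(w, Y)\<in>P. card Z \<le> card Y + 1)"
proof (induction "\<Sum>i\<in>UNIV. Poly_Mapping.lookup u i - Poly_Mapping.lookup v i"
    arbitrary: v rule: less_induct)
  case less
  show ?case
  proof (cases "v \<in> multiples u")
    case True
    \<comment> \<open>Every point of the box lies above the corner, so all of it consists of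
      multiples.\<close>
    then have empty: "box v Z - multiples u = {}"
      by (auto simp: box_def multiples_def intro: order_trans)
    show ?thesis
      unfolding empty using box_partition_empty by (intro exI[of _ "{}"]) simp
  next
    case False
    then obtain i where i: "Poly_Mapping.lookup v i < Poly_Mapping.lookup u i"
      by (auto simp: multiples_def not_le)
    show ?thesis
    proof (cases "i \<in> Z")
      case False
      \<comment> \<open>Coordinate \<open>i\<close> is frozen below that of \<open>u\<close>, so the
        box contains no multiple and is kept whole.\<close>
      then have all: "box v Z - multiples u = box v Z"
        using box_Int_multiples[OF False i] by blast
      show ?thesis
        unfolding all using box_partition_single[of v Z] by (intro exI[of _ "{(v, Z)}"]) simp
    next
      case True
      let ?v = "v + Poly_Mapping.single i 1"
      \<comment> \<open>The truncated difference at \<open>i\<close> is positive by the choice of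
        \<open>i\<close>, so raising the corner there strictly lowers the deficit.\<close>
      have "(\<Sum>j\<in>UNIV. Poly_Mapping.lookup u j - Poly_Mapping.lookup ?v j)
          < (\<Sum>j\<in>UNIV. Poly_Mapping.lookup u j - Poly_Mapping.lookup v j)"
        by (rule sum_strict_mono_ex1)
          (use i in \<open>auto simp: lookup_add lookup_single when_def intro!: bexI[of _ i]\<close>)
      from less[OF this] obtain P where P: "box_partition P (box ?v Z - multiples u)"
        "\<forall>(w, Y)\<in>P. card Z \<le> card Y + 1" by blast
      have sl: "box v (Z - {i}) \<inter> multiples u = {}"
        using i by (intro box_Int_multiples) simp_all
      \<comment> \<open>The slice and the remainder are indexed by booleans so that
        \<open>box_partition_UN\<close> glues them.\<close>
      let ?X = "\<lambda>b. if b then box v (Z - {i}) else box ?v Z - multiples u"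
      have "box_partition (\<Union>b\<in>UNIV. if b then {(v, Z - {i})} else P) (\<Union>b\<in>UNIV. ?X b)"
        by (rule box_partition_UN)
          (use P(1) box_split(2)[OF True, of v] box_partition_single[of v "Z - {i}"]
            in \<open>auto simp: disjoint_family_on_def\<close>)
      moreover have "(\<Union>b\<in>UNIV. ?X b) = box v Z - multiples u"
        using sl box_split(1)[OF True, of v] by (auto simp: UNIV_bool)
      moreover have "card Z \<le> card (Z - {i}) + 1"
        using card_Suc_Diff1[OF finite True] by simp
      ultimately show ?thesis using P(2)
        by (intro exI[of _ "\<Union>b\<in>UNIV. if b then {(v, Z - {i})} else P"]) (auto simp: UNIV_bool)
    qed
  qed
qed

text \<open>Induction on \<open>T\<close>: every box of the partition obtained so far is cut by the
  next \<open>u\<close>, at the cost of at most one variable. The additive form of the bound avoids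
  truncated subtraction.\<close>

lemma box_partition_non_multiples:
  fixes T :: "('n::finite \<Rightarrow>\<^sub>0 nat) set"
  assumes "finite T"
  shows "\<exists>P. box_partition P (- (\<Union>u\<in>T. multiples u)) \<and>
    (\<forall>(v, Z)\<in>P. CARD('n) \<le> card Z + card T)"
  using assms
proof (induction T rule: finite_induct)
  case empty
  then show ?case using box_partition_single[of "0 :: 'n \<Rightarrow>\<^sub>0 nat" UNIV]
    by (intro exI[of _ "{(0, UNIV)}"]) (simp add: box_UNIV)
next
  case (insert u T)
  then obtain P where P: "box_partition P (- (\<Union>u\<in>T. multiples u))"
    "\<forall>(v, Z)\<in>P. CARD('n) \<le> card Z + card T" by blast
  have "\<forall>p. \<exists>Q. box_partition Q (box (fst p) (snd p) - multiples u) \<and>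
      (\<forall>(w, Y)\<in>Q. card (snd p) \<le> card Y + 1)"
    using box_diff_multiples by blast
  then obtain Q where
    Q: "\<And>p. box_partition (Q p) (box (fst p) (snd p) - multiples u)"
      "\<And>p. \<forall>(w, Y)\<in>Q p. card (snd p) \<le> card Y + 1" by metis
  have "disjoint_family_on (\<lambda>p. box (fst p) (snd p) - multiples u) P"
    using P(1) unfolding box_partition_def disjoint_family_on_def case_prod_beta by blast
  then have "box_partition (\<Union>p\<in>P. Q p) (\<Union>p\<in>P. box (fst p) (snd p) - multiples u)"
    using P(1) Q(1) by (intro box_partition_UN) (simp_all add: box_partition_def)
  moreover have "(\<Union>p\<in>P. box (fst p) (snd p) - multiples u) = - (\<Union>u\<in>insert u T. multiples u)"
    using P(1) by (auto simp: box_partition_def case_prod_beta)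
  moreover have "CARD('n) \<le> card Y + card (insert u T)" if "(w, Y) \<in> Q p" "p \<in> P" for w Y p
    using Q(2)[of p] P(2) that insert.hyps by (force simp: case_prod_beta)
  ultimately show ?case by (intro exI[of _ "\<Union>p\<in>P. Q p"]) auto
qed

section \<open>Dickson's lemma\<close>

text \<open>Every sequence has a monotone subsequence, and a decreasing one in the naturals is
  eventually constant.\<close>

lemma nat_incseq_subseq:
  fixes s :: "nat \<Rightarrow> nat"
  shows "\<exists>r. strict_mono r \<and> incseq (s \<circ> r)"
proof -
  obtain r where r: "strict_mono r" "monoseq (\<lambda>n. s (r n))" using seq_monosub by blast
  show ?thesis
  proof (cases "incseq (\<lambda>n. s (r n))")
    case True
    then show ?thesis using r by (auto simp: o_def)
  next
    case False
    then have dec: "decseq (\<lambda>n. s (r n))"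
      using r(2) by (auto simp: monoseq_iff)
    \<comment> \<open>\<open>N\<close> is an index where the minimum is attained; from there on the
      decreasing sequence is constant.\<close>
    obtain N where N: "s (r N) \<le> s (r n)" for n
      using ex_has_least_nat[of "\<lambda>_. True" _ "\<lambda>n. s (r n)"] by blast
    have "s (r (n + N)) = s (r N)" for n
      using N[of "n + N"] decseqD[OF dec, of N "n + N"] by simp
    moreover have "strict_mono (\<lambda>n. r (n + N))"
      using r(1) by (simp add: strict_mono_def)
    ultimately show ?thesis by (intro exI[of _ "\<lambda>n. r (n + N)"]) (simp add: o_def)
  qed
qed

text \<open>A sequence of distinct vectors is thinned out one coordinate at a time until all of the
  finitely many coordinates increase. Its first two terms are then comparable, and still
  distinct.\<close>

lemma dickson:
  fixes T :: "('n::finite \<Rightarrow>\<^sub>0 nat) set"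
  assumes "infinite T"
  obtains s t where "s \<in> T" "t \<in> T" "s \<noteq> t" "t \<in> multiples s"
proof -
  obtain f :: "nat \<Rightarrow> _" where f: "inj f" "range f \<subseteq> T"
    using assms infinite_countable_subset by blast
  have "\<exists>r :: nat \<Rightarrow> nat. strict_mono r \<and> (\<forall>i\<in>A. incseq (\<lambda>n. Poly_Mapping.lookup (f (r n)) i))"
    if "finite A" for A :: "'n set"
    using that
  proof (induction A rule: finite_induct)
    case empty
    then show ?case by (intro exI[of _ id]) (simp add: strict_mono_def)
  next
    case (insert a A)
    then obtain r where r: "strict_mono r" "\<forall>i\<in>A. incseq (\<lambda>n. Poly_Mapping.lookup (f (r n)) i)"
      by blast
    obtain q where q: "strict_mono q" "incseq ((\<lambda>n. Poly_Mapping.lookup (f (r n)) a) \<circ> q)"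
      using nat_incseq_subseq by blast
    have "strict_mono (r \<circ> q)" using r(1) q(1) by (simp add: strict_mono_def)
    \<comment> \<open>Coordinates treated earlier stay increasing along the further subsequence
      \<open>q\<close>.\<close>
    moreover have "incseq (\<lambda>n. Poly_Mapping.lookup (f (r (q n))) i)" if "i \<in> A" for i
      using r(2) that strict_mono_mono[OF q(1)] unfolding incseq_def mono_def by blast
    ultimately show ?case using q(2) by (intro exI[of _ "r \<circ> q"]) (auto simp: o_def)
  qed
  from this[of UNIV]
  obtain r where r: "strict_mono r" "\<And>i. incseq (\<lambda>n. Poly_Mapping.lookup (f (r n)) i)"
    by auto
  have "r 0 \<noteq> r 1" using r(1) by (simp add: strict_mono_eq)
  then have "f (r 0) \<noteq> f (r 1)" using f(1) by (simp add: inj_eq)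
  moreover have "f (r 1) \<in> multiples (f (r 0))"
    using incseqD[OF r(2), of 0 1] by (simp add: multiples_def)
  ultimately show ?thesis using that f(2) by blast
qed

section \<open>The exponents of a monomial ideal\<close>

lemma inj_monomial: "inj (\<lambda>t. Poly_Mapping.single t 1 :: ('n::finite, 'k::field) mpoly)"
  by (rule injI) (metis keys_single one_neq_zero singleton_inject)

text \<open>Applied both to ideals and to sets of generators.\<close>

definition exponents :: "('n::finite, 'k::field) mpoly set \<Rightarrow> ('n \<Rightarrow>\<^sub>0 nat) set" where
  "exponents I = {t. Poly_Mapping.single t 1 \<in> I}"

lemma Idl_monomials_multiples:
  assumes "G \<subseteq> monomials"
  shows "Idl\<^bsub>poly_ring\<^esub> G = {f. Poly_Mapping.keys f \<subseteq> (\<Union>u\<in>exponents G. multiples u)}"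
  unfolding Idl_monomials[OF assms] exponents_def by (auto simp: multiples_iff subset_iff)

lemma exponents_Idl:
  assumes "G \<subseteq> monomials"
  shows "exponents (Idl\<^bsub>poly_ring\<^esub> G) = (\<Union>u\<in>exponents G. multiples u)"
  by (subst exponents_def) (auto simp: Idl_monomials_multiples[OF assms])

text \<open>This turns membership in \<open>I\<close>, and so equality in the quotient, into a
  statement about exponents.\<close>

lemma monomial_ideal_iff_keys:
  assumes "monomial_ideal I"
  shows "f \<in> I \<longleftrightarrow> Poly_Mapping.keys f \<subseteq> exponents I"
proof -
  obtain G where G: "G \<subseteq> monomials" "I = Idl\<^bsub>poly_ring\<^esub> G"
    using assms by (auto simp: monomial_ideal_def)
  then have "exponents I = (\<Union>u\<in>exponents G. multiples u)" by (simp add: exponents_Idl)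
  then show ?thesis unfolding G(2) Idl_monomials_multiples[OF G(1)] by simp
qed

text \<open>Among infinitely many generators, Dickson's lemma finds one that divides another.
  Dropping the latter leaves the ideal unchanged, against minimality.\<close>

lemma finite_exponents_min_gens:
  fixes I :: "('n::finite, 'k::field) mpoly set"
  assumes "is_min_monomial_gens I G"
  shows "finite (exponents G)"
proof (rule ccontr)
  assume "infinite (exponents G)"
  then obtain s t where st: "s \<in> exponents G" "t \<in> exponents G" "s \<noteq> t" "t \<in> multiples s"
    by (rule dickson)
  let ?H = "G - {Poly_Mapping.single t 1}"
  have G: "G \<subseteq> monomials" "Idl\<^bsub>poly_ring\<^esub> G = I"
    using assms by (auto simp: is_min_monomial_gens_def)
  have exps: "exponents ?H = exponents G - {t}"
    by (auto simp: exponents_def inj_eq[OF inj_monomial])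
  have "multiples t \<subseteq> multiples s"
    using st(4) by (auto simp: multiples_def intro: order_trans)
  \<comment> \<open>The multiples of \<open>t\<close> are already multiples of \<open>s\<close>, and
    \<open>s\<close> survives in \<open>?H\<close> because it differs from \<open>t\<close>.\<close>
  then have "(\<Union>u\<in>exponents ?H. multiples u) = (\<Union>u\<in>exponents G. multiples u)"
    unfolding exps using st(1,3) by blast
  moreover have "?H \<subseteq> monomials" using G(1) by blast
  ultimately have "Idl\<^bsub>poly_ring\<^esub> ?H = I"
    using G Idl_monomials_multiples by metis
  moreover have "?H \<subset> G" using st(2) by (auto simp: exponents_def)
  ultimately show False using assms by (auto simp: is_min_monomial_gens_def)
qed

lemma card_exponents:
  assumes "G \<subseteq> monomials"
  shows "card (exponents G) = card G"
proof (rule bij_betw_same_card)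
  show "bij_betw (\<lambda>t. Poly_Mapping.single t 1) (exponents G) G"
    using assms inj_monomial
    by (auto simp: bij_betw_def exponents_def monomials_def intro: inj_on_subset)
qed

section \<open>Stanley decompositions of the quotient\<close>

abbreviation residue ::
    "('n::finite, 'k::field) mpoly set \<Rightarrow> ('n, 'k) mpoly \<Rightarrow> ('n, 'k) mpoly set" where
  "residue I f \<equiv> I +>\<^bsub>poly_ring\<^esub> f"

lemma monomial_ideal_ideal:
  assumes "monomial_ideal I"
  shows "ideal I poly_ring"
proof -
  interpret R: cring poly_ring by (rule cring_poly_ring)
  show ?thesis using assms R.genideal_ideal by (auto simp: monomial_ideal_def)
qed

lemma
  fixes I :: "('n::finite, 'k::field) mpoly set"
  assumes "ideal I poly_ring"
  shows residue_zero: "residue I 0 = \<zero>\<^bsub>quot_module I\<^esub>"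
    and residue_add: "residue I f \<oplus>\<^bsub>quot_module I\<^esub> residue I g = residue I (f + g)"
    and residue_smult: "f \<odot>\<^bsub>quot_module I\<^esub> residue I g = residue I (f * g)"
    and residue_eq_iff: "residue I f = residue I g \<longleftrightarrow> f - g \<in> I"
proof -
  interpret R: cring "poly_ring :: ('n, 'k) mpoly ring" by (rule cring_poly_ring)
  interpret ideal I poly_ring by fact
  note I = ideal_poly_ringD[OF assms]
  show "residue I 0 = \<zero>\<^bsub>quot_module I\<^esub>"
    by (simp add: quot_module_simps a_r_coset_def')
  show "residue I f \<oplus>\<^bsub>quot_module I\<^esub> residue I g = residue I (f + g)"
    using a_rcos_sum[of f g] by (simp add: quot_module_def Let_def FactRing_def)
  show "f \<odot>\<^bsub>quot_module I\<^esub> residue I g = residue I (f * g)"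
    using rcoset_mult_add[of f g] by (simp add: quot_module_def Let_def FactRing_def)
  have "f \<ominus>\<^bsub>poly_ring\<^esub> g = f - g"
  proof -
    have "\<ominus>\<^bsub>poly_ring\<^esub> g = - g" by (rule R.add.inv_equality) auto
    then show ?thesis by (simp add: a_minus_def)
  qed
  then show "residue I f = residue I g \<longleftrightarrow> f - g \<in> I"
    using R.quotient_eq_iff_same_a_r_cos[OF assms, of f g] by simp
qed

lemma residue_sum:
  assumes "module poly_ring (quot_module I)" "ideal I poly_ring" "finite A"
  shows "finsum (quot_module I) (\<lambda>j. residue I (g j)) A = residue I (sum g A)"
proof -
  interpret M: module poly_ring "quot_module I" by fact
  show ?thesis using assms(3)
  proof (induction A rule: finite_induct)
    case empty
    then show ?case using residue_zero[OF assms(2)] by simp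
  next
    case (insert a A)
    then show ?case
      by (subst M.finsum_insert) (auto simp: quot_module_simps(1) residue_add[OF assms(2)])
  qed
qed

section \<open>Splitting the quotient along a partition of exponents\<close>

text \<open>For polynomials this is the linear projection onto the span of the monomials with
  exponents in \<open>B\<close>.\<close>

definition restrict_keys :: "('a \<Rightarrow>\<^sub>0 'b::zero) \<Rightarrow> 'a set \<Rightarrow> 'a \<Rightarrow>\<^sub>0 'b" where
  "restrict_keys f B = Abs_poly_mapping (\<lambda>t. if t \<in> B then Poly_Mapping.lookup f t else 0)"

lemma lookup_restrict_keys:
  "Poly_Mapping.lookup (restrict_keys f B) t = (if t \<in> B then Poly_Mapping.lookup f t else 0)"
proof -
  have "finite {t. (if t \<in> B then Poly_Mapping.lookup f t else 0) \<noteq> 0}"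
    by (rule finite_subset[OF _ finite_keys[of f]]) (auto simp: in_keys_iff)
  then show ?thesis by (simp add: restrict_keys_def)
qed

lemma keys_restrict_keys: "Poly_Mapping.keys (restrict_keys f B) = Poly_Mapping.keys f \<inter> B"
  by (auto simp: in_keys_iff lookup_restrict_keys split: if_splits)

lemma restrict_keys_diff:
  fixes f g :: "'a \<Rightarrow>\<^sub>0 'b::ab_group_add"
  shows "restrict_keys (f - g) B = restrict_keys f B - restrict_keys g B"
  by (rule poly_mapping_eqI) (simp add: lookup_restrict_keys lookup_minus)

text \<open>By disjointness no other summand has exponents in \<open>B i\<close>, so the projection
  recovers the summand \<open>g i\<close>.\<close>

lemma restrict_keys_sum:
  fixes g :: "'j \<Rightarrow> 'a \<Rightarrow>\<^sub>0 'b::comm_monoid_add"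
  assumes "finite J" "disjoint_family_on B J" "\<And>j. j \<in> J \<Longrightarrow> Poly_Mapping.keys (g j) \<subseteq> B j" "i \<in> J"
  shows "restrict_keys (sum g J) (B i) = g i"
proof (rule poly_mapping_eqI)
  fix t
  have z: "Poly_Mapping.lookup (g j) t = 0" if "j \<in> J" "t \<notin> B j" for j
    using assms(3)[OF that(1)] that(2) by (auto simp: in_keys_iff)
  have "(\<Sum>j\<in>J. Poly_Mapping.lookup (g j) t) = Poly_Mapping.lookup (g i) t" if "t \<in> B i"
  proof -
    have "t \<notin> B j" if "j \<in> J" "j \<noteq> i" for j
      using assms(2,4) that \<open>t \<in> B i\<close> by (auto simp: disjoint_family_on_def)
    then have "(\<Sum>j\<in>J. Poly_Mapping.lookup (g j) t)
        = (\<Sum>j\<in>J. if j = i then Poly_Mapping.lookup (g j) t else 0)"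
      by (intro sum.cong) (auto simp: z)
    then show ?thesis using assms(1,4) by simp
  qed
  then show "Poly_Mapping.lookup (restrict_keys (sum g J) (B i)) t = Poly_Mapping.lookup (g i) t"
    using z[OF assms(4)] by (simp add: lookup_restrict_keys lookup_sum)
qed

text \<open>The residues of the monomials outside \<open>I\<close> form a basis of the quotient, so
  a partition of their exponents splits it. The component of the residue of \<open>f\<close> at
  \<open>j\<close> is the residue of the projection of \<open>f\<close> to
  \<open>B j\<close>.\<close>

lemma is_direct_sum_residues:
  fixes I :: "('n::finite, 'k::field) mpoly set" and B :: "'j \<Rightarrow> ('n \<Rightarrow>\<^sub>0 nat) set"
  assumes mono: "monomial_ideal I" and mod: "module poly_ring (quot_module I)"
    and J: "finite J" "disjoint_family_on B J" "(\<Union>j\<in>J. B j) = - exponents I"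
    and A: "\<And>j. j \<in> J \<Longrightarrow> A j = residue I ` {f. Poly_Mapping.keys f \<subseteq> B j}"
  shows "is_direct_sum (quot_module I) A J"
  unfolding is_direct_sum_def
proof (intro conjI ballI)
  let ?M = "quot_module I"
  interpret M: module poly_ring ?M by (rule mod)
  note id = monomial_ideal_ideal[OF mono]
  note keysI = monomial_ideal_iff_keys[OF mono]
  {
    fix j assume j: "j \<in> J"
    have "subgroup (A j) (add_monoid ?M)"
    proof (rule M.M.add.subgroupI)
      show "A j \<subseteq> carrier ?M" by (auto simp: A[OF j] quot_module_simps)
      have "residue I 0 \<in> A j" by (simp add: A[OF j])
      then show "A j \<noteq> {}" by blast
    next
      fix x assume "x \<in> A j"
      then obtain f where f: "x = residue I f" "Poly_Mapping.keys f \<subseteq> B j" by (auto simp: A[OF j])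
      have "\<ominus>\<^bsub>?M\<^esub> x = residue I (- f)"
        by (rule M.M.add.inv_equality)
          (auto simp: f(1) residue_add[OF id] residue_zero[OF id] quot_module_simps(1))
      moreover have "Poly_Mapping.keys (- f) \<subseteq> B j" using f(2) by (simp add: in_keys_iff subset_iff)
      ultimately show "\<ominus>\<^bsub>?M\<^esub> x \<in> A j" by (auto simp: A[OF j])
    next
      fix x y assume "x \<in> A j" "y \<in> A j"
      then obtain f g where fg: "x = residue I f" "Poly_Mapping.keys f \<subseteq> B j"
        "y = residue I g" "Poly_Mapping.keys g \<subseteq> B j" by (auto simp: A[OF j])
      then have "Poly_Mapping.keys (f + g) \<subseteq> B j" using Poly_Mapping.keys_add[of f g] by blast
      then show "x \<oplus>\<^bsub>?M\<^esub> y \<in> A j" by (auto simp: A[OF j] fg residue_add[OF id])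
    qed
    then show "additive_subgroup (A j) ?M" by (rule additive_subgroup.intro)
  }
  fix x assume "x \<in> carrier ?M"
  then obtain f where x: "x = residue I f" by (auto simp: quot_module_simps)
  \<comment> \<open>Extending the sum from the support to all of \<open>J\<close> adds zero terms;
    it then becomes the residue of one polynomial.\<close>
  have fsum: "finsum ?M h {j. h j \<noteq> \<zero>\<^bsub>?M\<^esub>} = residue I (sum g J)"
    if h: "\<And>j. j \<in> J \<Longrightarrow> h j = residue I (g j)" "\<And>j. j \<notin> J \<Longrightarrow> h j = \<zero>\<^bsub>?M\<^esub>"
    for h and g :: "'j \<Rightarrow> ('n, 'k) mpoly"
  proof -
    have "finsum ?M h {j. h j \<noteq> \<zero>\<^bsub>?M\<^esub>} = finsum ?M (\<lambda>j. residue I (g j)) J"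
      by (rule M.add.finprod_mono_neutral_cong_left)
        (use h J(1) in \<open>auto simp: quot_module_simps(1)\<close>)
    then show ?thesis using residue_sum[OF mod id J(1)] by simp
  qed
  define h where "h j = (if j \<in> J then residue I (restrict_keys f (B j)) else \<zero>\<^bsub>?M\<^esub>)" for j
  show "\<exists>!h. (\<forall>j\<in>J. h j \<in> A j) \<and> (\<forall>j. j \<notin> J \<longrightarrow> h j = \<zero>\<^bsub>?M\<^esub>) \<and>
      finite {j. h j \<noteq> \<zero>\<^bsub>?M\<^esub>} \<and> x = finsum ?M h {j. h j \<noteq> \<zero>\<^bsub>?M\<^esub>}"
  proof (rule ex1I[of _ h], intro conjI)
    show "\<forall>j\<in>J. h j \<in> A j" by (auto simp: h_def A keys_restrict_keys)
    show "finite {j. h j \<noteq> \<zero>\<^bsub>?M\<^esub>}"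
      by (rule finite_subset[OF _ J(1)]) (auto simp: h_def)
    let ?g = "\<lambda>j. restrict_keys f (B j)"
    \<comment> \<open>On each \<open>B i\<close> the sum of the projections agrees with
      \<open>f\<close>, so the difference lives on the exponents of \<open>I\<close>.\<close>
    have "Poly_Mapping.keys (f - sum ?g J) \<subseteq> exponents I"
    proof
      fix t assume t: "t \<in> Poly_Mapping.keys (f - sum ?g J)"
      show "t \<in> exponents I"
      proof (rule ccontr)
        assume "t \<notin> exponents I"
        then obtain i where i: "i \<in> J" "t \<in> B i" using J(3) by blast
        have "restrict_keys (f - sum ?g J) (B i) = 0"
          unfolding restrict_keys_diff
          by (subst restrict_keys_sum[OF J(1,2)]) (auto simp: keys_restrict_keys i)
        then have "Poly_Mapping.lookup (restrict_keys (f - sum ?g J) (B i)) t = 0" by simp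
        then show False using t i(2) by (simp add: lookup_restrict_keys in_keys_iff)
      qed
    qed
    then have "residue I f = residue I (sum ?g J)"
      unfolding residue_eq_iff[OF id] keysI .
    then show "x = finsum ?M h {j. h j \<noteq> \<zero>\<^bsub>?M\<^esub>}"
      using fsum[of h ?g] by (simp add: x h_def)
  next
    fix k assume k: "(\<forall>j\<in>J. k j \<in> A j) \<and> (\<forall>j. j \<notin> J \<longrightarrow> k j = \<zero>\<^bsub>?M\<^esub>) \<and>
      finite {j. k j \<noteq> \<zero>\<^bsub>?M\<^esub>} \<and> x = finsum ?M k {j. k j \<noteq> \<zero>\<^bsub>?M\<^esub>}"
    have "\<exists>g. k j = residue I g \<and> Poly_Mapping.keys g \<subseteq> B j" if "j \<in> J" for j
    proof -
      have "k j \<in> residue I ` {f. Poly_Mapping.keys f \<subseteq> B j}"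
        using k that by (simp add: A[OF that, symmetric])
      then show ?thesis by blast
    qed
    then obtain g where g: "\<And>j. j \<in> J \<Longrightarrow> k j = residue I (g j)"
      "\<And>j. j \<in> J \<Longrightarrow> Poly_Mapping.keys (g j) \<subseteq> B j" by metis
    have "residue I f = residue I (sum g J)" using k fsum[of k g] g(1) x by simp
    then have fI: "Poly_Mapping.keys (f - sum g J) \<subseteq> exponents I"
      unfolding residue_eq_iff[OF id] keysI .
    show "k = h"
    proof
      fix j
      show "k j = h j"
      proof (cases "j \<in> J")
        case True
        \<comment> \<open>Projecting an element of \<open>I\<close> to \<open>B j\<close> stays in
          \<open>I\<close>. As the projection sends the sum to \<open>g j\<close>, the two
          components agree modulo \<open>I\<close>.\<close>
        have "Poly_Mapping.keys (restrict_keys (f - sum g J) (B j)) \<subseteq> exponents I"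
          using fI by (auto simp: keys_restrict_keys)
        then have "restrict_keys f (B j) - g j \<in> I"
          unfolding keysI restrict_keys_diff using restrict_keys_sum[OF J(1,2) g(2) True] by simp
        then have "residue I (restrict_keys f (B j)) = residue I (g j)"
          unfolding residue_eq_iff[OF id] .
        then show ?thesis using g(1)[OF True] True by (simp add: h_def)
      qed (use k in \<open>simp add: h_def\<close>)
    qed
  qed (simp add: h_def)
qed

section \<open>Multiplication by a monomial and the spaces of a Stanley decomposition\<close>

text \<open>Multiplication by the monomial shifts exponents by \<open>v\<close> injectively, so a
  single term contributes. This allows the monomial to be cancelled.\<close>

lemma lookup_mult_monomial:
  fixes f :: "('n::finite, 'k::field) mpoly"
  shows "Poly_Mapping.lookup (f * Poly_Mapping.single v 1) (t + v) = Poly_Mapping.lookup f t"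
proof -
  have "f * Poly_Mapping.single v 1
      = (\<Sum>s\<in>Poly_Mapping.keys f. Poly_Mapping.single (s + v) (Poly_Mapping.lookup f s))"
    by (subst (1) poly_eq_sum_terms[of "Poly_Mapping.keys f" f])
      (simp_all add: sum_distrib_right mult_single)
  then have "Poly_Mapping.lookup (f * Poly_Mapping.single v 1) (t + v)
      = (\<Sum>s\<in>Poly_Mapping.keys f. if s = t then Poly_Mapping.lookup f t else 0)"
    by (auto simp: lookup_sum lookup_single when_def intro!: sum.cong)
  then show ?thesis by (auto simp: in_keys_iff)
qed

lemma polys_in_mult_monomial:
  fixes v :: "'n::finite \<Rightarrow>\<^sub>0 nat"
  shows "(\<lambda>f. f * Poly_Mapping.single v (1::'k::field)) ` polys_in Z
    = {f. Poly_Mapping.keys f \<subseteq> box v Z}"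
proof (intro equalityI subsetI)
  fix g assume "g \<in> (\<lambda>f. f * Poly_Mapping.single v (1::'k)) ` polys_in Z"
  then obtain f where f: "g = f * Poly_Mapping.single v 1" "f \<in> polys_in Z" by blast
  then show "g \<in> {f. Poly_Mapping.keys f \<subseteq> box v Z}"
    using keys_mult[of f "Poly_Mapping.single v 1"] by (fastforce simp: polys_in_def box_iff)
next
  fix g :: "('n, 'k) mpoly" assume g: "g \<in> {f. Poly_Mapping.keys f \<subseteq> box v Z}"
  \<comment> \<open>The quotient of \<open>g\<close> by the monomial: all exponents of
    \<open>g\<close> lie above \<open>v\<close>, so the truncated differences are exact.\<close>
  define f where
    "f = (\<Sum>s\<in>Poly_Mapping.keys g. Poly_Mapping.single (s - v) (Poly_Mapping.lookup g s))"
  have sv: "s - v + v = s \<and> Poly_Mapping.keys (s - v) \<subseteq> Z" if "s \<in> Poly_Mapping.keys g" for s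
  proof -
    obtain w where "s = w + v" "Poly_Mapping.keys w \<subseteq> Z" using g \<open>s \<in> _\<close> box_iff by blast
    then show ?thesis by simp
  qed
  have "Poly_Mapping.keys f \<subseteq> (\<lambda>s. s - v) ` Poly_Mapping.keys g"
    unfolding f_def by (rule order_trans[OF keys_sum]) auto
  then have "f \<in> polys_in Z" using sv by (auto simp: polys_in_def)
  moreover have "f * Poly_Mapping.single v 1 = g"
    using poly_eq_sum_terms[of "Poly_Mapping.keys g" g] sv
    by (simp add: f_def sum_distrib_right mult_single)
  ultimately show "g \<in> (\<lambda>f. f * Poly_Mapping.single v (1::'k)) ` polys_in Z" by blast
qed

text \<open>If two products agree modulo \<open>I\<close>, the exponents of their difference lie
  both in the box and in \<open>exponents I\<close>, so the difference vanishes.\<close>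

lemma inj_on_smult_residue:
  fixes I :: "('n::finite, 'k::field) mpoly set"
  assumes mono: "monomial_ideal I" and "box v Z \<inter> exponents I = {}"
  shows "inj_on (\<lambda>f. f \<odot>\<^bsub>quot_module I\<^esub> residue I (Poly_Mapping.single v 1)) (polys_in Z)"
proof (rule inj_onI)
  note id = monomial_ideal_ideal[OF mono]
  let ?x = "Poly_Mapping.single v 1 :: ('n, 'k) mpoly"
  fix f g :: "('n, 'k) mpoly" assume fg: "f \<in> polys_in Z" "g \<in> polys_in Z"
  assume "f \<odot>\<^bsub>quot_module I\<^esub> residue I ?x = g \<odot>\<^bsub>quot_module I\<^esub> residue I ?x"
  then have "f * ?x - g * ?x \<in> I" by (simp add: residue_smult[OF id] residue_eq_iff[OF id])
  moreover have "Poly_Mapping.keys (f * ?x - g * ?x) \<subseteq> box v Z"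
    using fg polys_in_mult_monomial[of v Z, where 'k = 'k] keys_diff[of "f * ?x" "g * ?x"] by blast
  ultimately have "Poly_Mapping.keys (f * ?x - g * ?x) = {}"
    using assms(2) unfolding monomial_ideal_iff_keys[OF mono] by blast
  then have "f * ?x = g * ?x" by simp
  then show "f = g" by (metis lookup_mult_monomial poly_mapping_eqI)
qed

lemma stanley_decomposition_of_box_partition:
  fixes I :: "('n::finite, 'k::field) mpoly set"
  assumes mono: "monomial_ideal I" and proper: "I \<noteq> carrier poly_ring"
    and L: "distinct L" "box_partition (set L) (- exponents I)"
  shows "stanley_decomposition (quot_module I) (quot_grading I)
    (map (\<lambda>(v, Z). (residue I (Poly_Mapping.single v 1), Z)) L)"
    (is "stanley_decomposition _ _ ?D")
proof -
  note id = monomial_ideal_ideal[OF mono]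
  interpret multigraded_module "quot_module I" "quot_grading I"
    using mono proper by (rule multigraded_module_quot)
  let ?B = "\<lambda>i. box (fst (L ! i)) (snd (L ! i))"
  have "(\<exists>a. residue I (Poly_Mapping.single v 1) \<in> quot_grading I a) \<and>
      inj_on (\<lambda>f. f \<odot>\<^bsub>quot_module I\<^esub> residue I (Poly_Mapping.single v 1)) (polys_in Z)"
    if "(v, Z) \<in> set L" for v Z
  proof
    show "\<exists>a. residue I (Poly_Mapping.single v 1) \<in> quot_grading I a"
      \<comment> \<open>The multidegree of the monomial is its exponent vector.\<close>
      by (rule exI[of _ "\<lambda>i. int (Poly_Mapping.lookup v i)"])
        (auto simp: quot_grading_def poly_component_def)
    have "box v Z \<inter> exponents I = {}"
      using L(2) that by (auto simp: box_partition_def)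
    then show "inj_on (\<lambda>f. f \<odot>\<^bsub>quot_module I\<^esub> residue I (Poly_Mapping.single v 1)) (polys_in Z)"
      by (rule inj_on_smult_residue[OF mono])
  qed
  moreover have "is_direct_sum (quot_module I)
      (\<lambda>i. stanley_space (quot_module I) (fst (?D ! i)) (snd (?D ! i))) {..<length L}"
  proof (rule is_direct_sum_residues[OF mono module_axioms, of _ ?B])
    show "disjoint_family_on ?B {..<length L}"
      unfolding disjoint_family_on_def
    proof (intro ballI impI)
      fix i j assume "i \<in> {..<length L}" "j \<in> {..<length L}" "i \<noteq> j"
      \<comment> \<open>Distinctness of \<open>L\<close> carries disjointness over from pairs to
        list positions.\<close>
      then have "L ! i \<in> set L" "L ! j \<in> set L" "L ! i \<noteq> L ! j"
        using nth_eq_iff_index_eq[OF L(1)] by auto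
      then show "?B i \<inter> ?B j = {}"
        using L(2) unfolding box_partition_def disjoint_family_on_def case_prod_beta by blast
    qed
    show "(\<Union>i<length L. ?B i) = - exponents I"
    proof -
      have "(\<Union>i<length L. ?B i) = (\<Union>p\<in>set L. box (fst p) (snd p))"
        by (force simp: set_conv_nth)
      then show ?thesis using L(2) by (simp add: box_partition_def case_prod_beta)
    qed
    fix i assume "i \<in> {..<length L}"
    then have "stanley_space (quot_module I) (fst (?D ! i)) (snd (?D ! i))
        = residue I ` (\<lambda>f. f * Poly_Mapping.single (fst (L ! i)) 1) ` polys_in (snd (L ! i))"
      by (simp add: stanley_space_def case_prod_beta residue_smult[OF id] image_image)
    then show "stanley_space (quot_module I) (fst (?D ! i)) (snd (?D ! i))
        = residue I ` {f. Poly_Mapping.keys f \<subseteq> ?B i}"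
      unfolding polys_in_mult_monomial .
  qed simp
  ultimately show ?thesis by (auto simp: stanley_decomposition_def)
qed

section \<open>Bounding the Stanley depth from below\<close>

text \<open>An empty direct sum is zero, but the module is not. Hence \<open>Min\<close> in
  \<open>sdepth_of_decomposition\<close> ranges over a nonempty set.\<close>

lemma stanley_decomposition_nonempty:
  fixes M :: "(('n::finite, 'k::field) mpoly, 'm) module"
  assumes "multigraded_module M gr" "stanley_decomposition M gr D"
  shows "D \<noteq> []"
proof
  interpret multigraded_module M gr by fact
  assume "D = []"
  then have sum0: "is_direct_sum M (\<lambda>i. stanley_space M (fst (D ! i)) (snd (D ! i))) {}"
    using assms(2) by (simp add: stanley_decomposition_def)
  have "x = \<zero>\<^bsub>M\<^esub>" if "x \<in> carrier M" for x
  proof -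
    from sum0 that obtain h :: "nat \<Rightarrow> 'm" where "\<forall>j. h j = \<zero>\<^bsub>M\<^esub>"
      "x = finsum M h {j. h j \<noteq> \<zero>\<^bsub>M\<^esub>}" unfolding is_direct_sum_def by blast
    then show ?thesis by simp
  qed
  then show False using nonzero by blast
qed

text \<open>The depths of all decompositions are bounded by the number of variables, so
  \<open>Max\<close> is taken over a finite set and dominates the depth of \<open>D\<close>.\<close>

lemma sdepth_ge:
  fixes M :: "(('n::finite, 'k::field) mpoly, 'm) module"
  assumes M: "multigraded_module M gr" and D: "stanley_decomposition M gr D"
    and d: "\<And>m Z. (m, Z) \<in> set D \<Longrightarrow> d \<le> card Z"
  shows "d \<le> sdepth M gr"
proof -
  have "sdepth_of_decomposition D' \<le> CARD('n)" if D': "stanley_decomposition M gr D'" for D'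
  proof -
    obtain p where "p \<in> set D'"
      using stanley_decomposition_nonempty[OF M D'] by (meson last_in_set)
    then have "sdepth_of_decomposition D' \<le> card (snd p)"
      unfolding sdepth_of_decomposition_def by (intro Min_le) (auto simp: case_prod_beta)
    also have "\<dots> \<le> CARD('n)" by (rule card_mono) simp_all
    finally show ?thesis .
  qed
  then have "finite {sdepth_of_decomposition D | D. stanley_decomposition M gr D}"
    by (intro finite_subset[OF _ finite_atMost[of "CARD('n)"]]) auto
  then have "sdepth_of_decomposition D \<le> sdepth M gr"
    unfolding sdepth_def using D by (intro Max_ge) auto
  moreover have "d \<le> sdepth_of_decomposition D"
    unfolding sdepth_of_decomposition_def
    using stanley_decomposition_nonempty[OF M D] d by (intro Min.boundedI) auto
  ultimately show ?thesis by simp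
qed

theorem proposition1p2:
  fixes I :: "('n::finite, 'k::field) mpoly set"
  assumes "monomial_ideal I" and "I \<noteq> carrier poly_ring"
  shows "int (sdepth (quot_module I) (quot_grading I))
           \<ge> int CARD('n) - int (card (min_monomial_gens I))"
proof -
  define G where "G = min_monomial_gens I"
  have min: "is_min_monomial_gens I G"
    unfolding G_def min_monomial_gens_def by (rule theI'[OF ex1_min_monomial_gens[OF assms(1)]])
  then have G: "G \<subseteq> monomials" "Idl\<^bsub>poly_ring\<^esub> G = I" by (auto simp: is_min_monomial_gens_def)
  \<comment> \<open>The removed exponents are those of the minimal generators: their multiples make
    up \<open>exponents I\<close>, and they are as many as the elements of \<open>G\<close>.\<close>
  obtain P where P: "box_partition P (- exponents I)"
    "\<forall>(v, Z)\<in>P. CARD('n) \<le> card Z + card G"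
    using box_partition_non_multiples[OF finite_exponents_min_gens[OF min]]
      exponents_Idl[OF G(1)] G(2) card_exponents[OF G(1)] by metis
  then obtain L where L: "set L = P" "distinct L"
    unfolding box_partition_def by (metis finite_distinct_list)
  \<comment> \<open>The subtraction is truncated here; where it gives 0, the integer bound is at
    most 0 and still follows.\<close>
  have "CARD('n) - card G \<le> sdepth (quot_module I) (quot_grading I)"
    by (rule sdepth_ge[OF multigraded_module_quot[OF assms]
          stanley_decomposition_of_box_partition[OF assms L(2)]])
      (use P L in \<open>auto simp: le_diff_conv\<close>)
  then show ?thesis by (simp add: G_def)
qed

end
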